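(* Suppose that the pair $(A,C)$ is observable and that the eigenvalues of $A-LC$ are (real) negative and simple. Let $\widetilde{\gamma}>0$ be arbitrary, and define the numbers of subintervals $N_\ell$, $\ell\ge1$, recursively by $$N_{\ell} := \max \left\{N \; : \; 2\gamma\sum_{n=\ell}^{N-1} e^{\mu n\Delta T}B_n^{\ell} \leq \widetilde{\gamma}\, \dfrac{e^{-\mu T_{\ell-1}'}}{2^{\ell}} \right\},\qquad T_0'=0,\quad T_\ell'=\sum_{j=1}^\ell N_j\Delta T .$$ Then the rate of convergence of $\hat{x}_{\parallel}$ to $x$ is bounded by $\mu$, in the sense that, with $\varepsilon_\parallel(t):=x(t)-\hat x_\parallel(t)$, for every $\ell\ge1$, $$\|\varepsilon_{\parallel}( T_{\ell}')\| \leq \gamma \left(\|x(0) -\hat{x}_0\| +\widetilde{\gamma}\right)e^{-\mu T_\ell'}.$$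
   Context: Norms are Euclidean norms of vectors and induced 2-norms of matrices. Let $A\in\mathbb{R}^{m\times m}$, $B\in\mathbb{R}^{m\times p}$, $C\in\mathbb{R}^{q\times m}$, $L\in\mathbb{R}^{m\times q}$, and let $u:(0,\infty)\to\mathbb{R}^p$ be a given input (regular enough for the linear ODEs below to be well posed). The true state $x$ and output $y$ satisfy $\dot x=Ax+Bu$, $x(0)=x_0$, $y=Cx$. The system is observable if the matrix obtained by stacking $C,CA,\dots,CA^{m-1}$ has rank $m$. The observer equation is $\dot{\hat x}=A\hat x+Bu+L(y-C\hat x)$, with an arbitrary initial condition $\hat x_0\in\mathbb{R}^m$ at $t=0$. Put $\mu:=\min_{\nu\in\sigma(A-LC)}|\nu|$ and $\gamma:=\|V^{-1}\|\,\|V\|$, where $V$ is a fixed invertible matrix whose columns are eigenvectors of $A-LC$. Variable windows: $\Delta T>0$ is fixed; given positive integers $(N_\ell)_{\ell\ge1}$ and $T'_\ell=\sum_{j=1}^\ell N_j\Delta T$, put $t_n^\ell=T'_{\ell-1}+n\Delta T$ for $\ell\ge1$, $0\le n\le N_\ell$. The window $W'_\ell=(T'_{\ell-1},T'_\ell)$ is split into the subintervals $(t_n^\ell,t_{n+1}^\ell)$, $0\le n\le N_\ell-1$. Propagators: $\mathcal F(t_n^\ell,t_{n-1}^\ell,z)$ is the exact solution at $t_n^\ell$ of the observer equation started from $z$ at $t_{n-1}^\ell$; $\mathcal G(t_n^\ell,t_{n-1}^\ell,z)$ is its approximation by a coarse integrator. It is assumed that there are constants $\alpha,\beta>0$, $\eta\in(0,1)$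 such that, with $\tau:=\mathcal F-\mathcal G$, for all $\ell,n,y,z$: $\|\tau(t_n^\ell,z)\|\le\alpha$, $\|\tau(t_n^\ell,y)-\tau(t_n^\ell,z)\|\le\beta\|y-z\|$, and both $\mathcal F(t_n^\ell,t_{n-1}^\ell,\cdot)$ and $\mathcal G(t_n^\ell,t_{n-1}^\ell,\cdot)$ are Lipschitz with constant $\eta$. Define $B_n^k:=0$ if $n\le k$ and $B_n^k:=\alpha\beta^k\sum_{i=0}^{n-k-1}\binom{k+i}{k}\eta^i$ if $n>k$. Variable window algorithm: exactly $\ell$ parareal iterations are performed on $W'_\ell$. That is, $\hat X_{\ell,0}^k=\hat x_\parallel(T_{\ell-1}'^{\,-})$ for all $k$ ($=\hat x_0$ if $\ell=1$), $\hat X_{\ell,n}^0=\mathcal G(t_n^\ell,t_{n-1}^\ell,\hat X_{\ell,n-1}^0)$, and for $k\ge1$ $$\hat X_{\ell,n}^k=\mathcal F(t_n^\ell,t_{n-1}^\ell,\hat X_{\ell,n-1}^{k-1})+\mathcal G(t_n^\ell,t_{n-1}^\ell,\hat X_{\ell,n-1}^{k})-\mathcal G(t_n^\ell,t_{n-1}^\ell,\hat X_{\ell,n-1}^{k-1});$$ then on each $(t_n^\ell,t_{n+1}^\ell)$, $0\le n\le N_\ell-1$, $\hat x_\parallel$ is the solution of the observer equation with $\hat x_\parallel(t_n^{\ell+})=\hat X_{\ell,n}^{\ell}$. Thus $\hat x_\parallel$ is continuous at each $T'_\ell$ and $\hat x_\parallel(0)=\hat x_0$. Superscripts $\pm$ denote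 right/left limits. *)

theory Defs
  imports "HOL-Analysis.Analysis" "HOL-Computational_Algebra.Polynomial"
begin

subsection \<open>Matrices\<close>

text \<open>
  On the vector type, \<open>(*)\<close> and \<open>(^)\<close> act componentwise, so matrix powers need their own
  definition.
\<close>

primrec matrix_power :: "'a::semiring_1^'m^'m \<Rightarrow> nat \<Rightarrow> 'a^'m^'m" where
  "matrix_power A 0 = mat 1"
| "matrix_power A (Suc k) = A ** matrix_power A k"

text \<open>
  The stacked matrix of \<open>C, CA, \<dots>, CA\<^sup>m\<^sup>-\<^sup>1\<close>, where \<open>m = CARD('m)\<close>. Its rows are indexed by
  pairs (block, row inside the block); \<open>to_nat_on UNIV\<close> is a bijection from \<open>'m\<close> onto
  \<open>{..<m}\<close> and numbers the blocks. The order of the blocks does not affect the rank.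
\<close>

definition observability_matrix :: "real^'m^'m \<Rightarrow> real^'m^'q \<Rightarrow> real^'m^('m \<times> 'q)" where
  "observability_matrix A C =
     (\<chi> r. (C ** matrix_power A (to_nat_on UNIV (fst r))) $ snd r)"

definition observable :: "real^'m^'m \<Rightarrow> real^'m^'q \<Rightarrow> bool" where
  "observable A C \<longleftrightarrow> rank (observability_matrix A C) = CARD('m)"

definition complexify :: "real^'m^'n \<Rightarrow> complex^'m^'n" where
  "complexify M = map_matrix complex_of_real M"

definition is_eigenvector :: "complex^'m^'m \<Rightarrow> complex \<Rightarrow> complex^'m \<Rightarrow> bool" where
  "is_eigenvector M \<nu> v \<longleftrightarrow> v \<noteq> 0 \<and> M *v v = \<nu> *s v"

definition eigenvalues :: "complex^'m^'m \<Rightarrow> complex set" where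
  "eigenvalues M = {\<nu>. \<exists>v. is_eigenvector M \<nu> v}"

definition charpoly :: "complex^'m^'m \<Rightarrow> complex poly" where
  "charpoly M = det (mat [:0, 1:] - map_matrix (\<lambda>a. [:a:]) M)"

definition simple_eigenvalue :: "complex^'m^'m \<Rightarrow> complex \<Rightarrow> bool" where
  "simple_eigenvalue M \<nu> \<longleftrightarrow> \<nu> \<in> eigenvalues M \<and> order \<nu> (charpoly M) = 1"

definition matrix_norm :: "complex^'m^'n \<Rightarrow> real" where
  "matrix_norm M = onorm ((*v) M)"


subsection \<open>Differential equations\<close>

text \<open>
  \<open>w' = f(t, w)\<close> on the interval \<open>S\<close> in the sense of Caratheodory, i.e. in integrated form, so that
  inputs that are merely locally integrable are allowed.
\<close>

definition solves_on ::
  "(real \<Rightarrow> 'a \<Rightarrow> 'a) \<Rightarrow> real set \<Rightarrow> (real \<Rightarrow> 'a::euclidean_space) \<Rightarrow> bool" where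
  "solves_on f S w \<longleftrightarrow>
     (\<forall>s\<in>S. \<forall>t\<in>S. s \<le> t \<longrightarrow> ((\<lambda>r. f r (w r)) has_integral (w t - w s)) {s..t})"

definition state_rhs ::
  "real^'m^'m \<Rightarrow> real^'p^'m \<Rightarrow> (real \<Rightarrow> real^'p) \<Rightarrow> real \<Rightarrow> real^'m \<Rightarrow> real^'m" where
  "state_rhs A B u t z = A *v z + B *v u t"

definition observer_rhs ::
  "real^'m^'m \<Rightarrow> real^'p^'m \<Rightarrow> real^'m^'q \<Rightarrow> real^'q^'m \<Rightarrow> (real \<Rightarrow> real^'p) \<Rightarrow> (real \<Rightarrow> real^'q)
    \<Rightarrow> real \<Rightarrow> real^'m \<Rightarrow> real^'m" where
  "observer_rhs A B C L u y t z = A *v z + B *v u t + L *v (y t - C *v z)"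

definition exact_propagator ::
  "(real \<Rightarrow> 'a \<Rightarrow> 'a) \<Rightarrow> real \<Rightarrow> real \<Rightarrow> 'a::euclidean_space \<Rightarrow> 'a" where
  "exact_propagator f t s z = (THE v. \<exists>w. solves_on f {s..t} w \<and> w s = z \<and> w t = v)"


subsection \<open>Parareal iterations on windows of variable length\<close>

definition window_end :: "real \<Rightarrow> (nat \<Rightarrow> nat) \<Rightarrow> nat \<Rightarrow> real" where
  "window_end \<Delta>T N l = (\<Sum>j=1..l. real (N j) * \<Delta>T)"

definition grid_point :: "real \<Rightarrow> (nat \<Rightarrow> nat) \<Rightarrow> nat \<Rightarrow> nat \<Rightarrow> real" where
  "grid_point \<Delta>T N l n = window_end \<Delta>T N (l - 1) + real n * \<Delta>T"

definition parareal_bound :: "real \<Rightarrow> real \<Rightarrow> real \<Rightarrow> nat \<Rightarrow> nat \<Rightarrow> real" where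
  "parareal_bound \<alpha> \<beta> \<eta> k n =
     (if n \<le> k then 0
      else \<alpha> * \<beta> ^ k * (\<Sum>i=0..n - k - 1. real ((k + i) choose k) * \<eta> ^ i))"

text \<open>
  The propagators take the final time before the initial time, \<open>t\<close> is the grid of one window,
  \<open>X0\<close> the value at its left end, and \<open>parareal F G t X0 k n\<close> is the \<open>k\<close>-th iterate at \<open>t n\<close>.
\<close>

fun parareal ::
  "(real \<Rightarrow> real \<Rightarrow> 'a \<Rightarrow> 'a) \<Rightarrow> (real \<Rightarrow> real \<Rightarrow> 'a \<Rightarrow> 'a) \<Rightarrow> (nat \<Rightarrow> real) \<Rightarrow> 'a::ab_group_add
    \<Rightarrow> nat \<Rightarrow> nat \<Rightarrow> 'a" where
  "parareal F G t X0 k 0 = X0"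
| "parareal F G t X0 0 (Suc n) = G (t (Suc n)) (t n) (parareal F G t X0 0 n)"
| "parareal F G t X0 (Suc k) (Suc n) =
     F (t (Suc n)) (t n) (parareal F G t X0 k n)
     + G (t (Suc n)) (t n) (parareal F G t X0 (Suc k) n)
     - G (t (Suc n)) (t n) (parareal F G t X0 k n)"

definition window_start ::
  "real \<Rightarrow> (nat \<Rightarrow> nat) \<Rightarrow> 'a::t2_space \<Rightarrow> (real \<Rightarrow> 'a) \<Rightarrow> nat \<Rightarrow> 'a" where
  "window_start \<Delta>T N z0 w l = (if l = 1 then z0 else Lim (at_left (window_end \<Delta>T N (l - 1))) w)"

text \<open>
  \<open>w\<close> is the function computed by the algorithm for the equation with right-hand side \<open>f\<close>, initial
  value \<open>z0\<close> and coarse propagator \<open>G\<close>, with \<open>l\<close> iterations on window \<open>l\<close>. The second conjunct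
  fixes the value at the window boundaries by continuity; at grid points inside a window, where
  \<open>w\<close> may jump, its value is left open.
\<close>

definition variable_window_parareal ::
  "(real \<Rightarrow> 'a \<Rightarrow> 'a) \<Rightarrow> (real \<Rightarrow> real \<Rightarrow> 'a \<Rightarrow> 'a) \<Rightarrow> real \<Rightarrow> (nat \<Rightarrow> nat) \<Rightarrow> 'a::euclidean_space
    \<Rightarrow> (real \<Rightarrow> 'a) \<Rightarrow> bool" where
  "variable_window_parareal f G \<Delta>T N z0 w \<longleftrightarrow>
     (\<forall>l\<ge>1.
        (let t = grid_point \<Delta>T N l;
             X = parareal (exact_propagator f) G t (window_start \<Delta>T N z0 w l)
         in (\<forall>n<N l. solves_on f {t n<..<t (Suc n)} w \<and> (w \<longlongrightarrow> X l n) (at_right (t n)))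
            \<and> w (t 0) = window_start \<Delta>T N z0 w l))"

end

theory Submission
  imports Defs
begin

text \<open>
  Put \<open>K = A - L C\<close>. Since the output is exact, the true state itself solves the observer equation,
  so the error of any observer trajectory solves \<open>e' = K e\<close>. In the coordinates \<open>V\<^sup>-\<^sup>1 e\<close> each
  component is multiplied by an exponential, and the norm of the coordinate vector decays at rate
  \<open>\<mu>\<close> with constant 1. All intervals are therefore chained in these coordinates, and
  \<open>\<gamma> = \<parallel>V\<^sup>-\<^sup>1\<parallel> \<parallel>V\<parallel>\<close> is paid only once, for entering and leaving them.

  The computed trajectory solves the observer equation except at the inner grid points of a window,
  where it jumps from the fine propagation of the previous value to the parareal iterate. The error
  of the \<open>k\<close>-th iterate against the serial fine solution obeys a recursive inequality; with equality, its solution is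
  \<open>parareal_bound \<alpha> \<beta> \<eta> k n\<close> (\<open>parareal_error_le\<close>); hence the jump is at most twice that
  number (\<open>parareal_jump_le\<close>).

  Multiply the coordinate norm by \<open>exp (\<mu> t)\<close>. On one window the weighted quantity grows
  by at most the weighted sum of its jumps (\<open>weighted_error_growth\<close>), and the window length is chosen
  such that, after multiplication by \<open>\<parallel>V\<parallel>\<close>, this is at most \<open>\<gamma>' / 2\<^sup>l\<close> on window \<open>l\<close>. The geometric series
  bounds the total over all windows by \<open>\<gamma>'\<close>. The maximum that defines the window length exists because
  the sum of jump bounds is unbounded in the length, and it exceeds \<open>l\<close> because the first jump
  bounds vanish (\<open>Max_window_length\<close>).
\<close>

section \<open>Errors of the parareal iteration\<close>

lemma parareal_bound_lessThan:
  "parareal_bound \<alpha> \<beta> \<eta> k n = \<alpha> * \<beta> ^ k * (\<Sum>i<n - k. real ((k + i) choose k) * \<eta> ^ i)"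
proof (cases "n \<le> k")
  case False
  then have "{0..n - k - 1} = {..<n - k}" by auto
  then show ?thesis using False by (simp add: parareal_bound_def)
qed (simp add: parareal_bound_def)

lemma parareal_bound_at_0 [simp]: "parareal_bound \<alpha> \<beta> \<eta> k 0 = 0"
  by (simp add: parareal_bound_def)

lemma parareal_bound_no_iteration:
  "parareal_bound \<alpha> \<beta> \<eta> 0 (Suc n) = \<alpha> + \<eta> * parareal_bound \<alpha> \<beta> \<eta> 0 n"
  unfolding parareal_bound_lessThan
  by (simp add: sum.lessThan_Suc_shift sum_distrib_left algebra_simps del: sum.lessThan_Suc)

text \<open>
  Pascal's rule, summed. The \<open>(k + i) choose k * \<eta> ^ i\<close> are the coefficients of
  \<open>(1 - \<eta> z)\<^sup>-\<^sup>k\<^sup>-\<^sup>1\<close>; multiplying the series for \<open>Suc k\<close> by \<open>1 - \<eta> z\<close> gives the one for \<open>k\<close>, and the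
  factor \<open>z\<close> shifts the truncation by one.
\<close>

lemma truncated_binomial_series_Suc:
  fixes \<eta> :: real
  shows "(\<Sum>i<m. real ((Suc k + i) choose Suc k) * \<eta> ^ i)
    = (\<Sum>i<m. real ((k + i) choose k) * \<eta> ^ i)
      + \<eta> * (\<Sum>i<m - 1. real ((Suc k + i) choose Suc k) * \<eta> ^ i)"
proof (induction m)
  case (Suc m)
  show ?case
  proof (cases m)
    case (Suc m')
    define P Q where "P = (\<lambda>i. real ((k + i) choose k))" and "Q = (\<lambda>i. real ((Suc k + i) choose Suc k))"
    have pascal: "Q m = P m + Q m'"
      by (simp add: P_def Q_def Suc)
    have IH: "(\<Sum>i<m. Q i * \<eta> ^ i) = (\<Sum>i<m. P i * \<eta> ^ i) + \<eta> * (\<Sum>i<m'. Q i * \<eta> ^ i)"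
      using Suc.IH by (simp only: P_def Q_def Suc diff_Suc_1)
    have "\<eta> * (\<Sum>i<m. Q i * \<eta> ^ i) = \<eta> * (\<Sum>i<m'. Q i * \<eta> ^ i) + Q m' * \<eta> ^ m"
      by (simp add: Suc algebra_simps)
    moreover have "(\<Sum>i<Suc m. Q i * \<eta> ^ i)
        = (\<Sum>i<Suc m. P i * \<eta> ^ i) + \<eta> * (\<Sum>i<m'. Q i * \<eta> ^ i) + Q m' * \<eta> ^ m"
      by (simp only: sum.lessThan_Suc IH pascal) (simp add: algebra_simps)
    ultimately have "(\<Sum>i<Suc m. Q i * \<eta> ^ i) = (\<Sum>i<Suc m. P i * \<eta> ^ i) + \<eta> * (\<Sum>i<m. Q i * \<eta> ^ i)"
      by simp
    then show ?thesis by (simp only: P_def Q_def diff_Suc_1)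
  qed simp
qed simp

lemma parareal_bound_Suc_Suc:
  "parareal_bound \<alpha> \<beta> \<eta> (Suc k) (Suc n)
    = \<beta> * parareal_bound \<alpha> \<beta> \<eta> k n + \<eta> * parareal_bound \<alpha> \<beta> \<eta> (Suc k) n"
  unfolding parareal_bound_lessThan
  using truncated_binomial_series_Suc[where m = "n - k" and k = k and \<eta> = \<eta>]
  by (simp add: algebra_simps)

lemma parareal_bound_nonneg:
  assumes "0 \<le> \<alpha>" "0 \<le> \<beta>" "0 \<le> \<eta>"
  shows "0 \<le> parareal_bound \<alpha> \<beta> \<eta> k n"
  unfolding parareal_bound_lessThan using assms by (intro mult_nonneg_nonneg sum_nonneg) auto

lemma parareal_bound_mono:
  assumes "0 \<le> \<alpha>" "0 \<le> \<beta>" "0 \<le> \<eta>" "n \<le> n'"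
  shows "parareal_bound \<alpha> \<beta> \<eta> k n \<le> parareal_bound \<alpha> \<beta> \<eta> k n'"
  unfolding parareal_bound_lessThan using assms
  by (intro mult_left_mono sum_mono2) auto

text \<open>
  The summand \<open>i = 0\<close> alone; it keeps the weighted sums of these numbers from being bounded.
\<close>

lemma parareal_bound_ge:
  assumes "0 \<le> \<alpha>" "0 \<le> \<beta>" "0 \<le> \<eta>" "k < n"
  shows "\<alpha> * \<beta> ^ k \<le> parareal_bound \<alpha> \<beta> \<eta> k n"
  using parareal_bound_mono[of \<alpha> \<beta> \<eta> "Suc k" n k] assms
  by (simp add: parareal_bound_lessThan[of _ _ _ _ "Suc k"])

primrec serial_solution :: "(real \<Rightarrow> real \<Rightarrow> 'a \<Rightarrow> 'a) \<Rightarrow> (nat \<Rightarrow> real) \<Rightarrow> 'a \<Rightarrow> nat \<Rightarrow> 'a" where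
  "serial_solution F t z 0 = z"
| "serial_solution F t z (Suc n) = F (t (Suc n)) (t n) (serial_solution F t z n)"

text \<open>
  Writing \<open>F = \<tau> + G\<close>, the error \<open>E k n\<close> of an iterate against the serial fine solution is at most
  \<open>\<beta> * E (k - 1) (n - 1) + \<eta> * E k (n - 1)\<close> for \<open>k > 0\<close>, and at most \<open>\<alpha> + \<eta> * E 0 (n - 1)\<close> for
  \<open>k = 0\<close>. The numbers \<open>parareal_bound \<alpha> \<beta> \<eta> k n\<close>
  satisfy these relations with equality.
\<close>

lemma parareal_error_le:
  fixes F G :: "real \<Rightarrow> real \<Rightarrow> 'a \<Rightarrow> 'a::real_normed_vector"
  defines "\<tau> \<equiv> \<lambda>s r z. F s r z - G s r z"
  assumes "0 \<le> \<beta>" "0 \<le> \<eta>"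
    and tau_bound: "\<And>n z. n < m \<Longrightarrow> norm (\<tau> (t (Suc n)) (t n) z) \<le> \<alpha>"
    and tau_lip: "\<And>n z z'. n < m \<Longrightarrow>
      norm (\<tau> (t (Suc n)) (t n) z - \<tau> (t (Suc n)) (t n) z') \<le> \<beta> * norm (z - z')"
    and G_lip: "\<And>n. n < m \<Longrightarrow> lipschitz_on \<eta> UNIV (G (t (Suc n)) (t n))"
    and "n \<le> m"
  shows "norm (parareal F G t z k n - serial_solution F t z n) \<le> parareal_bound \<alpha> \<beta> \<eta> k n"
  using \<open>n \<le> m\<close>
proof (induction n arbitrary: k)
  case (Suc n)
  then have n: "n < m" and IH: "\<And>k. norm (parareal F G t z k n - serial_solution F t z n) \<le> parareal_bound \<alpha> \<beta> \<eta> k n"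
    by auto
  let ?s = "serial_solution F t z n" and ?X = "\<lambda>k. parareal F G t z k n"
  let ?F = "F (t (Suc n)) (t n)" and ?G = "G (t (Suc n)) (t n)" and ?\<tau> = "\<tau> (t (Suc n)) (t n)"
  have G: "norm (?G (?X k) - ?G ?s) \<le> \<eta> * parareal_bound \<alpha> \<beta> \<eta> k n" for k
    using lipschitz_on_normD[OF G_lip[OF n], of "?X k" ?s] mult_left_mono[OF IH[of k] \<open>0 \<le> \<eta>\<close>] by simp
  show ?case
  proof (cases k)
    case 0
    have "norm (parareal F G t z k (Suc n) - serial_solution F t z (Suc n))
        = norm ((?G (?X 0) - ?G ?s) - ?\<tau> ?s)"
      by (simp add: 0 \<tau>_def)
    also have "\<dots> \<le> norm (?G (?X 0) - ?G ?s) + norm (?\<tau> ?s)"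
      by (rule norm_triangle_ineq4)
    finally show ?thesis
      using G[of 0] tau_bound[OF n, of ?s] by (simp add: 0 parareal_bound_no_iteration)
  next
    case (Suc k')
    have "norm (parareal F G t z k (Suc n) - serial_solution F t z (Suc n))
        = norm ((?\<tau> (?X k') - ?\<tau> ?s) + (?G (?X k) - ?G ?s))"
      by (simp add: Suc \<tau>_def algebra_simps)
    also have "\<dots> \<le> norm (?\<tau> (?X k') - ?\<tau> ?s) + norm (?G (?X k) - ?G ?s)"
      by (rule norm_triangle_ineq)
    also have "\<dots> \<le> \<beta> * parareal_bound \<alpha> \<beta> \<eta> k' n + \<eta> * parareal_bound \<alpha> \<beta> \<eta> k n"
      using tau_lip[OF n, of "?X k'" ?s] mult_left_mono[OF IH[of k'] \<open>0 \<le> \<beta>\<close>] G[of k]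
      by linarith
    finally show ?thesis by (simp add: Suc parareal_bound_Suc_Suc)
  qed
qed simp

text \<open>
  The jump of the parallel solution at an inner grid point. The detour through the serial solution
  meets the error bound at two consecutive grid points, hence the factor 2.
\<close>

lemma parareal_jump_le:
  fixes F G :: "real \<Rightarrow> real \<Rightarrow> 'a \<Rightarrow> 'a::real_normed_vector"
  defines "\<tau> \<equiv> \<lambda>s r z. F s r z - G s r z"
  assumes "0 \<le> \<alpha>" "0 \<le> \<beta>" "0 \<le> \<eta>" "\<eta> \<le> 1"
    and tau_bound: "\<And>n z. n < m \<Longrightarrow> norm (\<tau> (t (Suc n)) (t n) z) \<le> \<alpha>"
    and tau_lip: "\<And>n z z'. n < m \<Longrightarrow>
      norm (\<tau> (t (Suc n)) (t n) z - \<tau> (t (Suc n)) (t n) z') \<le> \<beta> * norm (z - z')"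
    and F_lip: "\<And>n. n < m \<Longrightarrow> lipschitz_on \<eta> UNIV (F (t (Suc n)) (t n))"
    and G_lip: "\<And>n. n < m \<Longrightarrow> lipschitz_on \<eta> UNIV (G (t (Suc n)) (t n))"
    and n: "n < m"
  shows "norm (F (t (Suc n)) (t n) (parareal F G t z k n) - parareal F G t z k (Suc n))
    \<le> 2 * parareal_bound \<alpha> \<beta> \<eta> k (Suc n)"
proof -
  let ?s = "serial_solution F t z" and ?X = "parareal F G t z k" and ?F = "F (t (Suc n)) (t n)"
  let ?B = "parareal_bound \<alpha> \<beta> \<eta> k"
  have err: "norm (?X n' - ?s n') \<le> ?B n'" if "n' \<le> m" for n'
    using assms that by (intro parareal_error_le[where m = m]) auto
  have "norm (?F (?X n) - ?F (?s n)) \<le> \<eta> * norm (?X n - ?s n)"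
    using lipschitz_on_normD[OF F_lip[OF n], of "?X n" "?s n"] by simp
  also have "\<dots> \<le> norm (?X n - ?s n)"
    using \<open>\<eta> \<le> 1\<close> \<open>0 \<le> \<eta>\<close> by (simp add: mult_left_le_one_le)
  also have "\<dots> \<le> ?B n" using n by (intro err) simp
  also have "\<dots> \<le> ?B (Suc n)" using assms by (intro parareal_bound_mono) auto
  finally have "norm (?F (?X n) - ?F (?s n)) \<le> ?B (Suc n)" .
  moreover have "norm (?X (Suc n) - ?s (Suc n)) \<le> ?B (Suc n)" using n by (intro err) simp
  ultimately show ?thesis
    using norm_triangle_ineq4[of "?F (?X n) - ?F (?s n)" "?X (Suc n) - ?s (Suc n)"] by simp
qed

section \<open>Diagonalizable homogeneous equations\<close>

locale diagonalized =
  fixes K :: "real^'m^'m" and V :: "complex^'m^'m" and \<nu> :: "'m \<Rightarrow> complex"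
  assumes invertible_V: "invertible V"
    and eigenvector_column: "is_eigenvector (complexify K) (\<nu> j) (column j V)"
begin

lemma column_V: "complexify K *v column j V = \<nu> j *s column j V"
  using eigenvector_column by (simp add: is_eigenvector_def)

text \<open>
  The coordinates of a real vector in the eigenvector basis, in which the equation \<open>e' = K e\<close>
  decouples.
\<close>

definition modal :: "real^'m \<Rightarrow> complex^'m" where
  "modal v = matrix_inv V *v (\<chi> i. complex_of_real (v $ i))"

lemma V_matrix_inv: "V ** matrix_inv V = mat 1" "matrix_inv V ** V = mat 1"
proof -
  have "\<exists>W. V ** W = mat 1 \<and> W ** V = mat 1" using invertible_V by (simp add: invertible_def)
  from someI_ex[OF this] show "V ** matrix_inv V = mat 1" "matrix_inv V ** V = mat 1"
    by (simp_all add: matrix_inv_def)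
qed

lemma V_mult_matrix_inv [simp]: "V *v (matrix_inv V *v z) = z" "matrix_inv V *v (V *v z) = z"
  by (simp_all add: matrix_vector_mul_assoc V_matrix_inv)

lemma matrix_inv_V_mult:
  "(matrix_inv V *v (complexify K *v z)) $ j = \<nu> j * (matrix_inv V *v z) $ j"
proof -
  let ?c = "matrix_inv V *v z"
  have "complexify K *v z = complexify K *v (V *v ?c)" by simp
  also have "\<dots> = (\<Sum>j\<in>UNIV. complexify K *v (?c $ j *s column j V))"
    by (simp only: matrix_mult_sum[of V ?c] vec.linear_sum[OF matrix_vector_mul_linear_gen])
  also have "\<dots> = (\<Sum>j\<in>UNIV. (\<nu> j * ?c $ j) *s column j V)"
    by (simp add: vec.scale column_V mult.commute vec.linear_scale[OF matrix_vector_mul_linear_gen])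
  also have "\<dots> = V *v (\<chi> j. \<nu> j * ?c $ j)"
    by (simp add: matrix_mult_sum)
  finally show ?thesis by simp
qed

lemma complexify_mult:
  "(\<chi> i. complex_of_real ((K *v v) $ i)) = complexify K *v (\<chi> i. complex_of_real (v $ i))"
  by (simp add: vec_eq_iff matrix_vector_mult_def complexify_def map_matrix_def)

lemma modal_mult: "modal (K *v v) $ j = \<nu> j * modal v $ j"
  unfolding modal_def complexify_mult by (rule matrix_inv_V_mult)

lemma bounded_linear_modal: "bounded_linear modal"
proof -
  have "linear (\<lambda>v::real^'m. \<chi> i. complex_of_real (v $ i))"
    by (rule linearI) (simp_all add: vec_eq_iff scaleR_conv_of_real[where 'a = complex])
  then show ?thesis
    unfolding modal_def[abs_def]
    by (intro bounded_linear_compose[OF matrix_vector_mul_bounded_linear]) (simp add: linear_conv_bounded_linear)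
qed

lemma eigenvalues_eq: "eigenvalues (complexify K) = range \<nu>"
proof (intro equalityI subsetI)
  fix w assume "w \<in> eigenvalues (complexify K)"
  then obtain z where z: "z \<noteq> 0" "complexify K *v z = w *s z"
    by (auto simp: eigenvalues_def is_eigenvector_def)
  let ?c = "matrix_inv V *v z"
  have "?c \<noteq> 0" using z(1) by (metis V_mult_matrix_inv(1) matrix_vector_mult_0_right)
  then obtain j where j: "?c $ j \<noteq> 0" by (auto simp: vec_eq_iff)
  have "w * ?c $ j = \<nu> j * ?c $ j"
    using matrix_inv_V_mult[of z j]
    by (simp add: z(2) vec.linear_scale[OF matrix_vector_mul_linear_gen])
  then show "w \<in> range \<nu>" using j by auto
next
  fix w assume "w \<in> range \<nu>"
  then obtain j where j: "w = \<nu> j" by auto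
  then show "w \<in> eigenvalues (complexify K)"
    using eigenvector_column[of j] by (auto simp: eigenvalues_def)
qed

lemma norm_of_real_vec: "norm (\<chi> i. complex_of_real ((v::real^'m) $ i)) = norm v"
  by (simp add: norm_vec_def)

text \<open>
  The price of changing coordinates, once in each direction.
\<close>

lemma norm_le_modal: "norm v \<le> matrix_norm V * norm (modal v)"
proof -
  have "norm v = norm (V *v modal v)" by (simp add: modal_def norm_of_real_vec)
  also have "\<dots> \<le> matrix_norm V * norm (modal v)"
    unfolding matrix_norm_def by (rule onorm) simp
  finally show ?thesis .
qed

lemma norm_modal_le: "norm (modal v) \<le> matrix_norm (matrix_inv V) * norm v"
  unfolding modal_def matrix_norm_def
  using onorm[OF matrix_vector_mul_bounded_linear, of "matrix_inv V" "\<chi> i. complex_of_real (v $ i)"]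
  by (simp add: norm_of_real_vec)

lemma matrix_norm_nonneg: "0 \<le> matrix_norm (X :: complex^'m^'m)"
  unfolding matrix_norm_def by (rule onorm_pos_le) simp

lemma condition_number_ge_1: "1 \<le> matrix_norm (matrix_inv V) * matrix_norm V"
proof -
  define v :: "real^'m" where "v = axis undefined 1"
  have "norm v = 1" by (simp add: v_def)
  moreover have "norm v \<le> matrix_norm V * (matrix_norm (matrix_inv V) * norm v)"
    using norm_le_modal[of v] mult_left_mono[OF norm_modal_le[of v] matrix_norm_nonneg[of V]] by linarith
  ultimately show ?thesis by (simp add: mult.commute)
qed

lemma modal_eq_0: "modal v = 0 \<Longrightarrow> v = 0"
  using norm_le_modal[of v] by simp

end

lemma solves_on_subset: "solves_on f S w \<Longrightarrow> S' \<subseteq> S \<Longrightarrow> solves_on f S' w"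
  by (auto simp: solves_on_def)

lemma solves_on_continuous:
  assumes "solves_on f {a..b} w"
  shows "continuous_on {a..b} w"
proof (cases "a \<le> b")
  case True
  have int: "((\<lambda>r. f r (w r)) has_integral (w s - w a)) {a..s}" if "s \<in> {a..b}" for s
    using assms that True by (auto simp: solves_on_def)
  have "continuous_on {a..b} (\<lambda>s. w a + integral {a..s} (\<lambda>r. f r (w r)))"
    using int[of b] True by (intro continuous_intros indefinite_integral_continuous_1) auto
  then show ?thesis
    by (rule continuous_on_eq) (use integral_unique[OF int] in simp)
qed simp

text \<open>
  A solution of the integrated homogeneous equation is continuous, hence so is the integrand, and
  the equation holds in the differential sense. Each coordinate then solves a scalar linear
  equation, and its product with the inverse exponential has derivative 0.
\<close>

lemma (in diagonalized) modal_homogeneous_solution: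
  assumes e: "solves_on (\<lambda>_ z. K *v z) {s..t} e" and "s \<le> t"
  shows "modal (e t) $ j = exp ((t - s) *\<^sub>R \<nu> j) * modal (e s) $ j"
proof -
  have cont: "continuous_on {s..t} e" by (rule solves_on_continuous[OF e])
  have "continuous_on {s..t} (\<lambda>r. K *v e r)"
    by (rule bounded_linear.continuous_on[OF matrix_vector_mul_bounded_linear cont])
  have der: "(e has_vector_derivative K *v e r) (at r within {s..t})" if r: "r \<in> {s..t}" for r
  proof -
    have "((\<lambda>q. e s + integral {s..q} (\<lambda>r. K *v e r)) has_vector_derivative 0 + K *v e r) (at r within {s..t})"
      by (intro has_vector_derivative_add has_vector_derivative_const
          integral_has_vector_derivative[OF \<open>continuous_on {s..t} (\<lambda>r. K *v e r)\<close> r])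
    then have d: "((\<lambda>q. e s + integral {s..q} (\<lambda>r. K *v e r)) has_vector_derivative K *v e r) (at r within {s..t})"
      by simp
    show ?thesis
    proof (rule has_vector_derivative_transform[OF r _ d])
      fix q assume "q \<in> {s..t}"
      then have "((\<lambda>r. K *v e r) has_integral (e q - e s)) {s..q}"
        using e by (auto simp: solves_on_def)
      then show "e q = e s + integral {s..q} (\<lambda>r. K *v e r)" by (simp add: integral_unique)
    qed
  qed
  let ?c = "\<lambda>r. modal (e r) $ j"
  have c: "(?c has_vector_derivative \<nu> j * ?c r) (at r within {s..t})" if "r \<in> {s..t}" for r
    using bounded_linear.has_vector_derivative[OF bounded_linear_compose[OF bounded_linear_vec_nth bounded_linear_modal] der[OF that]]
    by (simp add: modal_mult)
  have "((\<lambda>r. exp (r *\<^sub>R (- \<nu> j)) * ?c r) has_vector_derivative 0) (at r within {s..t})"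
    if "r \<in> {s..t}" for r
    by (rule has_vector_derivative_eq_rhs[OF has_vector_derivative_mult[OF exp_scaleR_has_vector_derivative_right c[OF that]]])
      (simp add: algebra_simps)
  then have "exp (t *\<^sub>R (- \<nu> j)) * ?c t = exp (s *\<^sub>R (- \<nu> j)) * ?c s"
    unfolding has_vector_derivative_def
    by (intro has_derivative_zero_unique[of "{s..t}" "\<lambda>r. exp (r *\<^sub>R (- \<nu> j)) * ?c r" t s])
       (use \<open>s \<le> t\<close> in simp_all)
  then have "exp (t *\<^sub>R \<nu> j) * (exp (t *\<^sub>R (- \<nu> j)) * ?c t)
      = exp (t *\<^sub>R \<nu> j) * (exp (s *\<^sub>R (- \<nu> j)) * ?c s)" by (rule arg_cong)
  moreover have "exp (t *\<^sub>R \<nu> j) * exp (t *\<^sub>R (- \<nu> j)) = 1"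
    by (subst mult_exp_exp) simp
  moreover have "exp (t *\<^sub>R \<nu> j) * exp (s *\<^sub>R (- \<nu> j)) = exp ((t - s) *\<^sub>R \<nu> j)"
    by (subst mult_exp_exp) (simp add: scaleR_diff_left)
  ultimately show ?thesis by (simp only: mult.assoc[symmetric]) simp
qed

context diagonalized
begin

lemma modal_0 [simp]: "modal 0 = 0"
  using bounded_linear_modal by (rule linear_simps(3))

lemma modal_add: "modal (v + w) = modal v + modal w"
  using bounded_linear_modal by (rule linear_simps(1))

text \<open>
  In modal coordinates the decay has constant 1, so it can be iterated over arbitrarily many
  intervals; in the original norm every interval would contribute a factor \<open>\<parallel>V\<^sup>-\<^sup>1\<parallel> \<parallel>V\<parallel>\<close>.
\<close>

lemma norm_modal_decay:
  assumes "solves_on (\<lambda>_ z. K *v z) {s..t} e" "s \<le> t"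
    and "\<And>j. Re (\<nu> j) \<le> - \<mu>"
  shows "norm (modal (e t)) \<le> exp (- \<mu> * (t - s)) * norm (modal (e s))"
proof -
  have "norm (modal (e t) $ j) \<le> norm ((exp (- \<mu> * (t - s)) *\<^sub>R modal (e s)) $ j)" for j
  proof -
    have "(t - s) * Re (\<nu> j) \<le> (t - s) * - \<mu>"
      using assms by (intro mult_left_mono) auto
    then have "exp ((t - s) * Re (\<nu> j)) * norm (modal (e s) $ j) \<le> exp (- \<mu> * (t - s)) * norm (modal (e s) $ j)"
      by (intro mult_right_mono) (auto simp: mult.commute)
    then show ?thesis
      by (simp add: modal_homogeneous_solution[OF assms(1,2)] norm_mult norm_exp_eq_Re)
  qed
  from norm_le_componentwise_cart[OF this] show ?thesis by simp
qed

text \<open>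
  The real part of a superposition of complex modes; the real part solves the equation because \<open>K\<close>
  is real.
\<close>

lemma homogeneous_solution_exists:
  obtains e where "e s = v" "solves_on (\<lambda>_ z. K *v z) UNIV e"
proof -
  define p where "p = (\<lambda>j z. (\<chi> i. Re (z * V $ i $ j)) :: real^'m)"
  have lin: "bounded_linear (p j)" for j
    unfolding linear_conv_bounded_linear[symmetric]
    by (rule linearI) (simp_all add: p_def vec_eq_iff algebra_simps)
  have K_p: "K *v p j z = p j (\<nu> j * z)" for j z
  proof -
    have "(K *v p j z) $ i = Re (z * (complexify K *v column j V) $ i)" for i
      by (simp add: p_def matrix_vector_mult_def complexify_def map_matrix_def column_def
          sum_distrib_left algebra_simps)
    moreover have "z * (complexify K *v column j V) $ i = \<nu> j * z * V $ i $ j" for i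
      unfolding column_V by (simp add: column_def)
    ultimately have "(K *v p j z) $ i = Re (\<nu> j * z * V $ i $ j)" for i
      by (simp only:)
    then show ?thesis by (simp only: p_def vec_eq_iff vec_lambda_beta simp_thms)
  qed
  define e where "e = (\<lambda>r. \<Sum>j\<in>UNIV. p j (exp ((r - s) *\<^sub>R \<nu> j) * modal v $ j))"
  have "e s = v"
  proof -
    have "(e s) $ i = Re ((V *v modal v) $ i)" for i
      by (simp add: e_def p_def matrix_vector_mult_def mult.commute)
    then show ?thesis by (simp add: vec_eq_iff modal_def)
  qed
  moreover have der: "(e has_vector_derivative K *v e r) (at r within S)" for r S
  proof -
    have shift: "((\<lambda>r. exp ((r - s) *\<^sub>R \<nu> j)) has_vector_derivative exp ((r - s) *\<^sub>R \<nu> j) * \<nu> j) (at r within S)" for j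
    proof -
      have "((\<lambda>r. r - s) has_vector_derivative 1) (at r within S)"
        by (auto intro!: derivative_eq_intros)
      from vector_diff_chain_within[OF this exp_scaleR_has_vector_derivative_right[of "\<nu> j"]]
      show ?thesis by (simp add: o_def)
    qed
    have "(e has_vector_derivative (\<Sum>j\<in>UNIV. p j (exp ((r - s) *\<^sub>R \<nu> j) * \<nu> j * modal v $ j))) (at r within S)"
      unfolding e_def
      by (intro has_vector_derivative_sum bounded_linear.has_vector_derivative[OF lin]
          has_vector_derivative_mult_left shift)
    moreover have "K *v e r = (\<Sum>j\<in>UNIV. p j (exp ((r - s) *\<^sub>R \<nu> j) * \<nu> j * modal v $ j))"
      unfolding e_def
      by (simp add: linear_sum[OF matrix_vector_mul_linear] K_p algebra_simps)
    ultimately show ?thesis by simp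
  qed
  have "solves_on (\<lambda>_ z. K *v z) UNIV e"
    unfolding solves_on_def by (auto intro: fundamental_theorem_of_calculus der)
  ultimately show ?thesis by (rule that)
qed

end

section \<open>Linear observers\<close>

text \<open>
  An observer equation enters only through the homogeneous equation for differences of its
  solutions and through one global solution, the observed state.
\<close>

locale observed = diagonalized K V \<nu>
  for K :: "real^'m^'m" and V :: "complex^'m^'m" and \<nu> :: "'m \<Rightarrow> complex" +
  fixes f :: "real \<Rightarrow> real^'m \<Rightarrow> real^'m" and x :: "real \<Rightarrow> real^'m"
  assumes f_diff: "f r z - f r z' = K *v (z - z')"
    and x: "solves_on f {0..} x"
begin

lemma solves_diff:
  assumes "solves_on f S w" "solves_on f S w'"
  shows "solves_on (\<lambda>_ z. K *v z) S (\<lambda>r. w r - w' r)"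
  unfolding solves_on_def
proof (intro ballI impI)
  fix s t assume "s \<in> S" "t \<in> S" "s \<le> t"
  then have "((\<lambda>r. f r (w r) - f r (w' r)) has_integral ((w t - w s) - (w' t - w' s))) {s..t}"
    using assms by (intro has_integral_diff) (auto simp: solves_on_def)
  then show "((\<lambda>r. K *v (w r - w' r)) has_integral (w t - w' t - (w s - w' s))) {s..t}"
    by (simp add: f_diff algebra_simps)
qed

text \<open>
  Subtracting a homogeneous solution from the observed state reaches every initial value.
\<close>

lemma solution_exists:
  assumes "0 \<le> s"
  obtains w where "w s = z" "solves_on f {s..t} w"
proof -
  obtain e where e: "e s = x s - z" "solves_on (\<lambda>_ z. K *v z) UNIV e"
    by (rule homogeneous_solution_exists)
  have "solves_on f {s..t} (\<lambda>r. x r - e r)"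
    unfolding solves_on_def
  proof (intro ballI impI)
    fix a b assume "a \<in> {s..t}" "b \<in> {s..t}" "a \<le> b"
    then have "((\<lambda>r. f r (x r) - K *v e r) has_integral ((x b - x a) - (e b - e a))) {a..b}"
      using x e(2) assms by (intro has_integral_diff) (auto simp: solves_on_def)
    moreover have "f r (x r) - K *v e r = f r (x r - e r)" for r
      using f_diff[of r "x r" "x r - e r"] by (simp add: algebra_simps)
    ultimately show "((\<lambda>r. f r (x r - e r)) has_integral (x b - e b - (x a - e a))) {a..b}"
      by (simp add: algebra_simps)
  qed
  with e(1) show ?thesis by (intro that[of "\<lambda>r. x r - e r"]) auto
qed

lemma solution_unique:
  assumes "solves_on f {s..t} w" "solves_on f {s..t} w'" "w s = w' s" "s \<le> t"
  shows "w t = w' t"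
proof -
  have "modal (w t - w' t) = 0"
    using modal_homogeneous_solution[OF solves_diff[OF assms(1,2)] \<open>s \<le> t\<close>] assms(3)
    by (simp add: vec_eq_iff modal_0)
  then show ?thesis using modal_eq_0 by fastforce
qed

lemma exact_propagator_eq:
  assumes "solves_on f {s..t} w" "s \<le> t"
  shows "exact_propagator f t s (w s) = w t"
  unfolding exact_propagator_def using assms solution_unique by (intro the_equality) blast+

lemma propagator_contracts:
  assumes "0 \<le> s" "s \<le> t" and "\<And>j. Re (\<nu> j) \<le> - \<mu>"
  shows "norm (modal (x t - exact_propagator f t s z))
    \<le> exp (- \<mu> * (t - s)) * norm (modal (x s - z))"
proof -
  obtain w where w: "w s = z" "solves_on f {s..t} w" by (rule solution_exists[OF \<open>0 \<le> s\<close>])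
  have "solves_on f {s..t} x" by (rule solves_on_subset[OF x]) (use \<open>0 \<le> s\<close> in auto)
  then have "norm (modal (x t - w t)) \<le> exp (- \<mu> * (t - s)) * norm (modal (x s - w s))"
    by (intro norm_modal_decay solves_diff w assms)
  then show ?thesis using exact_propagator_eq[OF w(2) \<open>s \<le> t\<close>] w(1) by simp
qed

text \<open>
  A solution on an open interval is only tied to its initial value through a limit. The modes of
  its difference to the solution on the closed interval are multiples of exponentials that tend to 0
  at the left end, so they vanish.
\<close>

lemma tendsto_exact_propagator:
  assumes w: "solves_on f {s<..<t} w" "(w \<longlongrightarrow> z) (at_right s)" and "0 \<le> s" "s < t"
  shows "(w \<longlongrightarrow> exact_propagator f t s z) (at_left t)"
proof -
  obtain w' where w': "w' s = z" "solves_on f {s..t} w'" by (rule solution_exists[OF \<open>0 \<le> s\<close>])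
  have cont: "continuous_on {s..t} w'" by (rule solves_on_continuous[OF w'(2)])
  have "(w' \<longlongrightarrow> z) (at_right s)"
    using cont w'(1) \<open>s < t\<close> by (auto simp: continuous_on_Icc_at_rightD)
  from tendsto_diff[OF w(2) this] have lim: "((\<lambda>q. w q - w' q) \<longlongrightarrow> 0) (at_right s)" by simp
  have eq: "w r = w' r" if r: "r \<in> {s<..<t}" for r
  proof -
    have "modal (w r - w' r) $ j = 0" for j
    proof -
      have "((\<lambda>q. exp ((r - q) *\<^sub>R \<nu> j) * modal (w q - w' q) $ j)
          \<longlongrightarrow> exp ((r - s) *\<^sub>R \<nu> j) * modal 0 $ j) (at_right s)"
        by (intro tendsto_intros bounded_linear.tendsto[OF bounded_linear_modal lim])
      moreover have "\<forall>\<^sub>F q in at_right s. exp ((r - q) *\<^sub>R \<nu> j) * modal (w q - w' q) $ j = modal (w r - w' r) $ j"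
      proof (rule eventually_at_rightI[of s r])
        fix q assume q: "q \<in> {s<..<r}"
        have "solves_on (\<lambda>_ z. K *v z) {q..r} (\<lambda>r. w r - w' r)"
          by (intro solves_diff solves_on_subset[OF w(1)] solves_on_subset[OF w'(2)]) (use q r in auto)
        then show "exp ((r - q) *\<^sub>R \<nu> j) * modal (w q - w' q) $ j = modal (w r - w' r) $ j"
          using modal_homogeneous_solution[of q r "\<lambda>r. w r - w' r" j] q by simp
      qed (use r in simp)
      ultimately have "((\<lambda>q. modal (w r - w' r) $ j) \<longlongrightarrow> exp ((r - s) *\<^sub>R \<nu> j) * modal 0 $ j) (at_right s)"
        by (rule Lim_transform_eventually)
      then show ?thesis
        by (simp add: tendsto_const_iff modal_0)
    qed
    then have "modal (w r - w' r) = 0" by (simp add: vec_eq_iff)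
    then show ?thesis using modal_eq_0 by fastforce
  qed
  have "(w' \<longlongrightarrow> w' t) (at_left t)"
    using cont \<open>s < t\<close> by (auto simp: continuous_on_Icc_at_leftD)
  moreover have "\<forall>\<^sub>F r in at_left t. w' r = w r"
    by (rule eventually_at_leftI[of s]) (use eq \<open>s < t\<close> in auto)
  ultimately have "(w \<longlongrightarrow> w' t) (at_left t)" by (rule Lim_transform_eventually)
  then show ?thesis using exact_propagator_eq[OF w'(2)] w'(1) \<open>s < t\<close> by simp
qed

text \<open>
  One window, seen through its modal coordinates: between grid points the error contracts, and each
  inner grid point adds a jump. Weighting with \<open>exp (\<mu> * n * \<Delta>T)\<close> turns the contraction into a
  telescoping sum.
\<close>

lemma weighted_error_growth:
  fixes \<Delta>T :: real and t :: "nat \<Rightarrow> real" and X :: "nat \<Rightarrow> real^'m"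
  assumes "0 \<le> t 0" "0 \<le> \<Delta>T" and t: "\<And>n. t (Suc n) = t n + \<Delta>T"
    and decay: "\<And>j. Re (\<nu> j) \<le> - \<mu>"
    and jump: "\<And>n. Suc n < m \<Longrightarrow> norm (exact_propagator f (t (Suc n)) (t n) (X n) - X (Suc n)) \<le> 2 * b (Suc n)"
    and "b 0 = 0" "0 < m"
  shows "exp (\<mu> * real m * \<Delta>T) * norm (modal (x (t m) - exact_propagator f (t m) (t (m - 1)) (X (m - 1))))
    \<le> norm (modal (x (t 0) - X 0))
       + 2 * matrix_norm (matrix_inv V) * (\<Sum>i<m. exp (\<mu> * real i * \<Delta>T) * b i)"
proof -
  let ?F = "\<lambda>n. exact_propagator f (t (Suc n)) (t n) (X n)" and ?c = "matrix_norm (matrix_inv V)"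
  let ?S = "\<lambda>n. \<Sum>i<n. exp (\<mu> * real i * \<Delta>T) * b i"
  let ?E = "\<lambda>n. exp (\<mu> * real n * \<Delta>T)"
  have t_nonneg: "0 \<le> t n" for n
    by (induction n) (use assms in auto)
  have contract: "?E (Suc n) * norm (modal (x (t (Suc n)) - ?F n)) \<le> ?E n * norm (modal (x (t n) - X n))" for n
  proof -
    have "norm (modal (x (t (Suc n)) - ?F n)) \<le> exp (- \<mu> * \<Delta>T) * norm (modal (x (t n) - X n))"
      using propagator_contracts[OF t_nonneg _ decay, of n "t (Suc n)" "X n"] \<open>0 \<le> \<Delta>T\<close> by (simp add: t)
    then have "?E (Suc n) * norm (modal (x (t (Suc n)) - ?F n))
        \<le> ?E (Suc n) * (exp (- \<mu> * \<Delta>T) * norm (modal (x (t n) - X n)))"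
      by (rule mult_left_mono) simp
    moreover have "?E (Suc n) * exp (- \<mu> * \<Delta>T) = ?E n"
      unfolding mult_exp_exp by (simp add: algebra_simps)
    ultimately show ?thesis by (simp only: mult.assoc[symmetric])
  qed
  have inner: "?E n * norm (modal (x (t n) - X n)) \<le> norm (modal (x (t 0) - X 0)) + 2 * ?c * ?S (Suc n)"
    if "n < m" for n
    using that
  proof (induction n)
    case (Suc n)
    have "modal (x (t (Suc n)) - X (Suc n)) = modal (x (t (Suc n)) - ?F n) + modal (?F n - X (Suc n))"
      by (simp add: modal_add[symmetric])
    then have "norm (modal (x (t (Suc n)) - X (Suc n)))
        \<le> norm (modal (x (t (Suc n)) - ?F n)) + norm (modal (?F n - X (Suc n)))"
      by (metis norm_triangle_ineq)
    moreover have "norm (modal (?F n - X (Suc n))) \<le> ?c * (2 * b (Suc n))"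
      using norm_modal_le[of "?F n - X (Suc n)"] mult_left_mono[OF jump[OF Suc.prems] matrix_norm_nonneg[of "matrix_inv V"]]
      by linarith
    ultimately have "?E (Suc n) * norm (modal (x (t (Suc n)) - X (Suc n)))
        \<le> ?E (Suc n) * (norm (modal (x (t (Suc n)) - ?F n)) + ?c * (2 * b (Suc n)))"
      by (intro mult_left_mono) auto
    also have "\<dots> \<le> ?E n * norm (modal (x (t n) - X n)) + 2 * ?c * (?E (Suc n) * b (Suc n))"
      using contract[of n] by (simp add: distrib_left mult_ac)
    also have "\<dots> \<le> norm (modal (x (t 0) - X 0)) + 2 * ?c * ?S (Suc n) + 2 * ?c * (?E (Suc n) * b (Suc n))"
      using Suc by simp
    also have "\<dots> = norm (modal (x (t 0) - X 0)) + 2 * ?c * ?S (Suc (Suc n))"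
      by (subst sum.lessThan_Suc[of _ "Suc n"]) (simp only: distrib_left add.assoc)
    finally show ?case .
  qed (simp add: \<open>b 0 = 0\<close>)
  show ?thesis
    using order_trans[OF contract[of "m - 1"] inner[of "m - 1"]] \<open>0 < m\<close> by simp
qed

end

section \<open>Window lengths\<close>

lemma window_end_0 [simp]: "window_end \<Delta>T N 0 = 0"
  by (simp add: window_end_def)

lemma window_end_Suc: "window_end \<Delta>T N (Suc l) = window_end \<Delta>T N l + real (N (Suc l)) * \<Delta>T"
  by (simp add: window_end_def)

text \<open>
  The set of admissible window lengths is bounded: from \<open>l + 1\<close> on, every summand is at least
  \<open>\<alpha> * \<beta> ^ l\<close>. It contains \<open>l + 1\<close>, for which the sum vanishes, so windows are never empty.
\<close>

lemma Max_window_length: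
  fixes l :: nat
  assumes "0 < \<alpha>" "0 < \<beta>" "0 \<le> \<eta>" "0 \<le> \<mu>" "0 \<le> \<Delta>T" "0 < c" "0 \<le> d"
  defines "S \<equiv> \<lambda>n. \<Sum>i=l..<n. exp (\<mu> * real i * \<Delta>T) * parareal_bound \<alpha> \<beta> \<eta> l i"
  defines "m \<equiv> Max {n. c * S n \<le> d}"
  shows "c * S m \<le> d" "l < m"
proof -
  have summand: "\<alpha> * \<beta> ^ l \<le> exp (\<mu> * real i * \<Delta>T) * parareal_bound \<alpha> \<beta> \<eta> l i" if "l < i" for i
  proof -
    have "1 * (\<alpha> * \<beta> ^ l) \<le> exp (\<mu> * real i * \<Delta>T) * parareal_bound \<alpha> \<beta> \<eta> l i"
      using assms that by (intro mult_mono parareal_bound_ge) auto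
    then show ?thesis by simp
  qed
  have S_l: "S (Suc l) = 0" by (simp add: S_def parareal_bound_def)
  have lower: "real (n - Suc l) * (\<alpha> * \<beta> ^ l) \<le> S n" for n
  proof (cases "l < n")
    case True
    then have "S n = (\<Sum>i=Suc l..<n. exp (\<mu> * real i * \<Delta>T) * parareal_bound \<alpha> \<beta> \<eta> l i)"
      by (simp add: S_def sum.atLeast_Suc_lessThan parareal_bound_def)
    moreover have "(\<Sum>i=Suc l..<n. \<alpha> * \<beta> ^ l) \<le> \<dots>"
      by (intro sum_mono summand) auto
    ultimately show ?thesis by simp
  qed (simp add: S_def)
  have "n \<le> Suc l + nat \<lceil>d / (c * (\<alpha> * \<beta> ^ l))\<rceil>" if "c * S n \<le> d" for n
  proof -
    have "real (n - Suc l) * (c * (\<alpha> * \<beta> ^ l)) \<le> c * S n"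
      using lower[of n] assms by (simp add: mult_ac mult_left_mono)
    then have "real (n - Suc l) * (c * (\<alpha> * \<beta> ^ l)) \<le> d" using that by simp
    then have "real (n - Suc l) \<le> d / (c * (\<alpha> * \<beta> ^ l))"
      using assms by (simp add: pos_le_divide_eq)
    then show ?thesis by linarith
  qed
  then have "{n. c * S n \<le> d} \<subseteq> {..Suc l + nat \<lceil>d / (c * (\<alpha> * \<beta> ^ l))\<rceil>}" by auto
  then have fin: "finite {n. c * S n \<le> d}" by (rule finite_subset) simp
  have mem: "Suc l \<in> {n. c * S n \<le> d}" using S_l assms by simp
  show "c * S m \<le> d" using Max_in[OF fin] mem unfolding m_def by blast
  show "l < m" using Max_ge[OF fin mem] by (simp add: m_def)
qed

section \<open>Convergence of the parallel observer\<close>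

theorem proposition4p5:
  fixes A :: "real^'m^'m" and B :: "real^'p^'m" and C :: "real^'m^'q" and L :: "real^'q^'m"
    and u :: "real \<Rightarrow> real^'p" and x :: "real \<Rightarrow> real^'m" and y :: "real \<Rightarrow> real^'q"
    and x0 xhat0 :: "real^'m" and xpar :: "real \<Rightarrow> real^'m"
    and M V :: "complex^'m^'m"
    and F G :: "real \<Rightarrow> real \<Rightarrow> real^'m \<Rightarrow> real^'m"
    and \<tau> :: "nat \<Rightarrow> nat \<Rightarrow> real^'m \<Rightarrow> real^'m"
    and t :: "nat \<Rightarrow> nat \<Rightarrow> real" and T :: "nat \<Rightarrow> real" and N :: "nat \<Rightarrow> nat"
    and \<mu> \<gamma> \<gamma>' \<alpha> \<beta> \<eta> \<Delta>T :: real
  assumes M_def: "M = complexify (A - L ** C)"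
    and obs: "observable A C"
    and eig: "\<forall>\<nu>\<in>eigenvalues M. \<nu> \<in> \<real> \<and> Re \<nu> < 0 \<and> simple_eigenvalue M \<nu>"
    and \<mu>_def: "\<mu> = Min (cmod ` eigenvalues M)"
    and V: "invertible V" "\<forall>j. \<exists>\<nu>. is_eigenvector M \<nu> (column j V)"
    and \<gamma>_def: "\<gamma> = matrix_norm (matrix_inv V) * matrix_norm V"
    and u: "\<forall>b>0. u absolutely_integrable_on {0<..b}"
    and x: "solves_on (state_rhs A B u) {0..} x" "x 0 = x0"
    and y: "\<forall>s\<ge>0. y s = C *v x s"
    and \<Delta>T: "\<Delta>T > 0"
    and T_def: "T = window_end \<Delta>T N"
    and t_def: "t = grid_point \<Delta>T N"
    and F_def: "F = exact_propagator (observer_rhs A B C L u y)"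
    and \<tau>_def: "\<tau> = (\<lambda>l n z. F (t l n) (t l (n - 1)) z - G (t l n) (t l (n - 1)) z)"
    and pos: "\<alpha> > 0" "\<beta> > 0" "0 < \<eta>" "\<eta> < 1"
    and tau_bound: "\<forall>l\<ge>1. \<forall>n\<in>{1..N l}. \<forall>z. norm (\<tau> l n z) \<le> \<alpha>"
    and tau_lip: "\<forall>l\<ge>1. \<forall>n\<in>{1..N l}. \<forall>z z'. norm (\<tau> l n z - \<tau> l n z') \<le> \<beta> * norm (z - z')"
    and F_lip: "\<forall>l\<ge>1. \<forall>n\<in>{1..N l}. lipschitz_on \<eta> UNIV (F (t l n) (t l (n - 1)))"
    and G_lip: "\<forall>l\<ge>1. \<forall>n\<in>{1..N l}. lipschitz_on \<eta> UNIV (G (t l n) (t l (n - 1)))"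
    and \<gamma>': "\<gamma>' > 0"
    and N: "\<forall>l\<ge>1. N l =
      Max {n. 2 * \<gamma> * (\<Sum>i=l..<n. exp (\<mu> * real i * \<Delta>T) * parareal_bound \<alpha> \<beta> \<eta> l i)
              \<le> \<gamma>' * (exp (- \<mu> * T (l - 1)) / 2 ^ l)}"
    and xpar: "variable_window_parareal (observer_rhs A B C L u y) G \<Delta>T N xhat0 xpar"
  shows "\<forall>l\<ge>1. norm (x (T l) - xpar (T l)) \<le> \<gamma> * (norm (x 0 - xhat0) + \<gamma>') * exp (- \<mu> * T l)"
proof -
  define f where "f = observer_rhs A B C L u y"
  define X where "X = (\<lambda>l n. parareal F G (t l) (window_start \<Delta>T N xhat0 xpar l) l n)"
  obtain \<nu> where \<nu>: "\<And>j. is_eigenvector M (\<nu> j) (column j V)"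
    using V(2) by metis
  interpret observed "A - L ** C" V \<nu> f x
  proof
    show "invertible V" by (rule V(1))
    show "is_eigenvector (complexify (A - L ** C)) (\<nu> j) (column j V)" for j
      using \<nu> M_def by simp
    show "f r z - f r z' = (A - L ** C) *v (z - z')" for r z z'
      by (simp add: f_def observer_rhs_def matrix_vector_mult_diff_distrib
          matrix_vector_mult_diff_rdistrib matrix_vector_mul_assoc algebra_simps)
    show "solves_on f {0..} x"
      unfolding solves_on_def
    proof (intro ballI impI)
      fix s r :: real assume s: "s \<in> {0..}" and r: "r \<in> {0..}" "s \<le> r"
      have "((\<lambda>q. state_rhs A B u q (x q)) has_integral (x r - x s)) {s..r}"
        using x(1) s r by (auto simp: solves_on_def)
      then show "((\<lambda>q. f q (x q)) has_integral (x r - x s)) {s..r}"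
        by (rule has_integral_eq[rotated]) (use s y in \<open>auto simp: f_def observer_rhs_def state_rhs_def\<close>)
    qed
  qed
  \<comment> \<open>The spectrum is finite, nonempty and real negative, so its least modulus is a decay rate.\<close>
  have range_\<nu>: "eigenvalues M = range \<nu>" using eigenvalues_eq M_def by simp
  have decay: "Re (\<nu> j) \<le> - \<mu>" for j
  proof -
    have "\<mu> \<le> cmod (\<nu> j)" unfolding \<mu>_def range_\<nu> by (intro Min_le) auto
    moreover have "\<nu> j \<in> \<real>" "Re (\<nu> j) < 0" using eig range_\<nu> by auto
    ultimately show ?thesis by (auto simp: in_Reals_norm)
  qed
  have "\<mu> \<in> cmod ` eigenvalues M"
    unfolding \<mu>_def range_\<nu> by (intro Min_in) auto
  then have "0 \<le> \<mu>" by auto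
  have \<gamma>_pos: "1 \<le> \<gamma>" using condition_number_ge_1 \<gamma>_def by simp
  let ?S = "\<lambda>l. \<Sum>i=l..<N l. exp (\<mu> * real i * \<Delta>T) * parareal_bound \<alpha> \<beta> \<eta> l i"
  have window: "2 * \<gamma> * ?S l \<le> \<gamma>' * (exp (- \<mu> * T (l - 1)) / 2 ^ l)" "l < N l" if "1 \<le> l" for l
    using Max_window_length[of \<alpha> \<beta> \<eta> \<mu> \<Delta>T "2 * \<gamma>" "\<gamma>' * (exp (- \<mu> * T (l - 1)) / 2 ^ l)" l]
      N that pos \<open>0 \<le> \<mu>\<close> \<Delta>T \<gamma>_pos \<gamma>'
    by simp_all
  have T_nonneg: "0 \<le> T l" for l
    unfolding T_def window_end_def using \<Delta>T by (intro sum_nonneg) auto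
  have t_0: "t l 0 = T (l - 1)" and t_Suc: "t l (Suc n) = t l n + \<Delta>T" for l n
    by (simp_all add: t_def grid_point_def T_def algebra_simps)
  have t_N: "t (Suc l) (N (Suc l)) = T (Suc l)" for l
    by (simp add: t_def grid_point_def T_def window_end_Suc)
  have t_nonneg: "0 \<le> t l n" for l n
    by (induction n) (use T_nonneg t_0 t_Suc \<Delta>T in auto)
  have pieces: "solves_on f {t l n<..<t l (Suc n)} xpar" "(xpar \<longlongrightarrow> X l n) (at_right (t l n))"
    if "1 \<le> l" "n < N l" for l n
    using xpar that unfolding variable_window_parareal_def Let_def X_def F_def f_def t_def by blast+
  have start: "xpar (T l) = X (Suc l) 0" for l
  proof -
    have "xpar (t (Suc l) 0) = window_start \<Delta>T N xhat0 xpar (Suc l)"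
      using xpar le_add1[of 1 l] unfolding variable_window_parareal_def Let_def t_def plus_1_eq_Suc by blast
    then show ?thesis by (simp add: t_0 X_def)
  qed
  \<comment> \<open>No jump at the end of a window: the next one starts from the left limit.\<close>
  have boundary: "xpar (T l) = F (t l (N l)) (t l (N l - 1)) (X l (N l - 1))" if l: "1 \<le> l" for l
  proof -
    have n: "N l - 1 < N l" "Suc (N l - 1) = N l" using window(2)[OF l] by auto
    have "(xpar \<longlongrightarrow> exact_propagator f (t l (N l)) (t l (N l - 1)) (X l (N l - 1))) (at_left (t l (N l)))"
      using tendsto_exact_propagator[OF pieces[OF l n(1)] t_nonneg] n(2) t_Suc[of l "N l - 1"] \<Delta>T by simp
    then have "Lim (at_left (T l)) xpar = F (t l (N l)) (t l (N l - 1)) (X l (N l - 1))"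
      using t_N[of "l - 1"] l by (intro tendsto_Lim) (auto simp: F_def f_def)
    moreover have "X (Suc l) 0 = Lim (at_left (T l)) xpar"
      using l by (simp add: X_def window_start_def T_def)
    ultimately show ?thesis using start by simp
  qed
  \<comment> \<open>The factor \<open>matrix_norm V\<close> makes the constant in front of the jump bounds equal to \<open>2 * \<gamma>\<close>.\<close>
  define W where "W = (\<lambda>l. matrix_norm V * (exp (\<mu> * T l) * norm (modal (x (T l) - xpar (T l)))))"
  have W_step: "W l \<le> W (l - 1) + \<gamma>' / 2 ^ l" if l: "1 \<le> l" for l
  proof -
    let ?b = "parareal_bound \<alpha> \<beta> \<eta> l" and ?c = "matrix_norm (matrix_inv V)"
    have jump: "norm (exact_propagator f (t l (Suc n)) (t l n) (X l n) - X l (Suc n)) \<le> 2 * ?b (Suc n)"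
      if n: "Suc n < N l" for n
    proof -
      have "norm (F (t l (Suc n)) (t l n) (parareal F G (t l) z l n) - parareal F G (t l) z l (Suc n))
          \<le> 2 * ?b (Suc n)" for z
      proof (rule parareal_jump_le[where m = "N l"])
        fix i z z' assume i: "i < N l"
        then have mem: "Suc i \<in> {1..N l}" by simp
        show "norm (F (t l (Suc i)) (t l i) z - G (t l (Suc i)) (t l i) z) \<le> \<alpha>"
          using tau_bound l mem unfolding \<tau>_def by fastforce
        show "norm (F (t l (Suc i)) (t l i) z - G (t l (Suc i)) (t l i) z
            - (F (t l (Suc i)) (t l i) z' - G (t l (Suc i)) (t l i) z')) \<le> \<beta> * norm (z - z')"
          using tau_lip[rule_format, OF l mem, of z z'] unfolding \<tau>_def by simp
        show "lipschitz_on \<eta> UNIV (F (t l (Suc i)) (t l i))"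
          using F_lip[rule_format, OF l mem] by simp
        show "lipschitz_on \<eta> UNIV (G (t l (Suc i)) (t l i))"
          using G_lip[rule_format, OF l mem] by simp
      qed (use pos n in auto)
      then show ?thesis by (simp add: X_def F_def f_def)
    qed
    have "(\<Sum>i<N l. exp (\<mu> * real i * \<Delta>T) * ?b i) = ?S l"
      by (rule sum.mono_neutral_right) (auto simp: parareal_bound_def)
    moreover have "exp (\<mu> * real (N l) * \<Delta>T) * norm (modal (x (t l (N l))
        - exact_propagator f (t l (N l)) (t l (N l - 1)) (X l (N l - 1))))
        \<le> norm (modal (x (t l 0) - X l 0)) + 2 * ?c * (\<Sum>i<N l. exp (\<mu> * real i * \<Delta>T) * ?b i)"
    proof (rule weighted_error_growth[where t = "t l" and X = "X l"])
      show "0 < N l" using window(2)[OF l] by simp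
    qed (use t_nonneg \<Delta>T t_Suc decay jump in simp_all)
    moreover have "t l (N l) = T l" "X l 0 = xpar (T (l - 1))"
      using t_N[of "l - 1"] start[of "l - 1"] l by simp_all
    ultimately have "exp (\<mu> * real (N l) * \<Delta>T) * norm (modal (x (T l) - xpar (T l)))
        \<le> norm (modal (x (T (l - 1)) - xpar (T (l - 1)))) + 2 * ?c * ?S l"
      using boundary[OF l] t_0[of l] by (simp add: F_def f_def)
    then have "matrix_norm V * (exp (\<mu> * T (l - 1)) * (exp (\<mu> * real (N l) * \<Delta>T) * norm (modal (x (T l) - xpar (T l)))))
        \<le> matrix_norm V * (exp (\<mu> * T (l - 1)) * (norm (modal (x (T (l - 1)) - xpar (T (l - 1)))) + 2 * ?c * ?S l))"
      by (intro mult_left_mono matrix_norm_nonneg) auto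
    moreover have "exp (\<mu> * T l) = exp (\<mu> * T (l - 1)) * exp (\<mu> * real (N l) * \<Delta>T)"
      using l window_end_Suc[of \<Delta>T N "l - 1"] unfolding mult_exp_exp by (simp add: T_def algebra_simps)
    ultimately have "W l \<le> W (l - 1) + exp (\<mu> * T (l - 1)) * (2 * \<gamma> * ?S l)"
      unfolding W_def \<gamma>_def by (simp add: algebra_simps)
    also have "\<dots> \<le> W (l - 1) + exp (\<mu> * T (l - 1)) * (\<gamma>' * (exp (- \<mu> * T (l - 1)) / 2 ^ l))"
      by (intro add_left_mono mult_left_mono window(1) l) simp
    also have "\<dots> = W (l - 1) + \<gamma>' / 2 ^ l"
      by (simp add: exp_minus)
    finally show ?thesis .
  qed
  have W_0: "W 0 \<le> \<gamma> * norm (x 0 - xhat0)"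
    using start[of 0] mult_left_mono[OF norm_modal_le matrix_norm_nonneg[of V], of "x 0 - xhat0"]
    by (simp add: W_def T_def X_def window_start_def \<gamma>_def mult_ac)
  have W_le: "W l \<le> \<gamma> * norm (x 0 - xhat0) + \<gamma>' * (1 - 1 / 2 ^ l)" for l
  proof (induction l)
    case (Suc l)
    then show ?case using W_step[of "Suc l"] by (simp add: algebra_simps)
  qed (use W_0 in simp)
  show ?thesis
  proof (intro allI impI)
    fix l :: nat
    have "norm (x (T l) - xpar (T l)) \<le> matrix_norm V * norm (modal (x (T l) - xpar (T l)))"
      by (rule norm_le_modal)
    also have "\<dots> = W l * exp (- \<mu> * T l)"
      by (simp add: W_def exp_minus)
    also have "\<dots> \<le> (\<gamma> * (norm (x 0 - xhat0) + \<gamma>')) * exp (- \<mu> * T l)"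
    proof (rule mult_right_mono)
      have "\<gamma>' * (1 - 1 / 2 ^ l) \<le> \<gamma>' * 1" using \<gamma>' by (intro mult_left_mono) auto
      also have "\<dots> \<le> \<gamma> * \<gamma>'" using \<gamma>_pos \<gamma>' by simp
      finally show "W l \<le> \<gamma> * (norm (x 0 - xhat0) + \<gamma>')"
        using W_le[of l] by (simp add: distrib_left)
    qed simp
    finally show "norm (x (T l) - xpar (T l)) \<le> \<gamma> * (norm (x 0 - xhat0) + \<gamma>') * exp (- \<mu> * T l)" .
  qed
qed

end
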